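(* Let $(\xi_k)_{k\in\mathbb{N}}$ be the Markov chain $\xi_{k+1}=F(\xi_k,\omega_k)$ with deterministic initial condition $\xi_0>0$, where $F$ and $(\omega_k)$ are as in the context, and suppose $\gamma>\frac12$. Then: (i) For all $0<p\le 1$ and all $\nu>0$, there exists $\xi_*>\xi_+$ such that for all $\xi_0\ge\xi_*$, $$\mathbb{P}\left(\forall k\in\mathbb{N},\ \left(\xi_0+k^{\frac12}\right)^{1-\nu}\le\xi_k\le\left(\xi_0+k^{\frac12}\right)^{1+\nu}\right)\ge 1-p .$$ (ii) For all $\nu>0$, $$\lim_{\xi_0\to+\infty}\mathbb{P}\left(\forall k\in\mathbb{N},\ \left(\xi_0+k^{\frac12}\right)^{1-\nu}\le\xi_k\le\left(\xi_0+k^{\frac12}\right)^{1+\nu}\right)=1 .$$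
   Context: $(\omega_k)_{k\in\mathbb{N}}$ is a family of i.i.d. real random variables with $\mathbb{E}(\omega_k)=0$, $\mathbb{E}(\omega_k^2)=1$ and $|\omega_k|\le M$ for some $M\ge1$. $F:(0,+\infty)\times[-M,M]\to(0,+\infty)$ is a measurable function for which there exist $\gamma\in\mathbb{R}$, $0<\xi_-<\xi_+$, $\alpha>0$, $\beta>1$ such that $F$ is continuous on $[\xi_-,+\infty)\times[-M,M]$ and, for all $\xi>\xi_+$, $$F(\xi,\omega)=\xi+\omega+\frac{\gamma}{\xi}+G_0(\xi,\omega)+G_1(\xi,\omega),$$ where, as $\xi\to+\infty$, $\sup_\omega|G_0(\xi,\omega)|=O(\xi^{-\alpha})$ and $\sup_\omega|G_1(\xi,\omega)|=O(\xi^{-\beta})$, and where $\mathbb{E}(G_0(\xi,\omega_k))=0$. *)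

theory Defs
  imports "HOL-Probability.Probability" "HOL-Library.Landau_Symbols"
begin

primrec chain :: "(real \<Rightarrow> real \<Rightarrow> real) \<Rightarrow> (nat \<Rightarrow> 'a \<Rightarrow> real) \<Rightarrow> real \<Rightarrow> nat \<Rightarrow> 'a \<Rightarrow> real" where
  "chain F \<omega> x0 0 s = x0"
| "chain F \<omega> x0 (Suc k) s = F (chain F \<omega> x0 k s) (\<omega> k s)"

(* The supremum over S of |G \<xi> w| is O(g \<xi>) as \<xi> tends to infinity. On type real, SUP is
   unspecified for sets that are unbounded above, so finiteness for all large \<xi> is required
   explicitly. *)
definition sup_bigo :: "real set \<Rightarrow> (real \<Rightarrow> real \<Rightarrow> real) \<Rightarrow> (real \<Rightarrow> real) \<Rightarrow> bool" where
  "sup_bigo S G g \<longleftrightarrow>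
     (\<forall>\<^sub>F \<xi> in at_top. bdd_above ((\<lambda>w. \<bar>G \<xi> w\<bar>) ` S)) \<and>
     (\<lambda>\<xi>. SUP w\<in>S. \<bar>G \<xi> w\<bar>) \<in> O[at_top](g)"

end

theory Submission
  imports Defs "HOL-Real_Asymp.Real_Asymp"
begin

text \<open>
  The increments of the chain at a distant position \<open>x\<close> have mean \<open>\<gamma> / x\<close> and variance \<open>1\<close> to leading
  order. Two consequences drive the proof. The mean of the squared position grows by at most a constant
  per step, which limits the growth of the chain from above. And for a small \<open>a > 0\<close> the function
  \<open>x powr (-a)\<close> decreases in mean, by a relative amount of order \<open>1 / x\<^sup>2\<close>, because \<open>\<gamma> > 1/2\<close>; this
  pushes the chain away from the origin (\<open>eventually_negative_power_drift\<close>).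

  Both effects are combined in one function of position and time. With clock \<open>t = \<xi>0\<^sup>2 + k\<close> at step \<open>k\<close>,
  \<open>t powr (a * (1 - \<nu>) / 2) * x powr (-a) + t powr (-\<nu> - 1) * x\<^sup>2\<close>
  plus suitable multiples of \<open>t powr (-\<nu>)\<close> and \<open>t powr (-(a * \<nu> / 2))\<close> is a supermartingale as long as
  the chain is far from the origin (\<open>barrier_drift\<close>). Where this barrier is below \<open>1\<close>, the position lies
  between \<open>t powr ((1 - \<nu>) / 2)\<close> and \<open>t powr ((1 + \<nu>) / 2)\<close>, which in particular is far from the
  origin for large \<open>\<xi>0\<close>. By a maximal inequality (\<open>chain_maximal_inequality\<close>) the probability that the
  barrier ever reaches \<open>1\<close> is at most its initial value, and this is a sum of negative powers of \<open>\<xi>0\<close>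
  (\<open>barrier_start_tendsto_0\<close>). A single inequality thus controls all times simultaneously. Since
  \<open>\<xi>0\<^sup>2 + k\<close> and \<open>(\<xi>0 + sqrt k)\<^sup>2\<close> are comparable, the asserted envelope follows from that of the
  barrier after a slight change of \<open>\<nu>\<close>.
\<close>

section \<open>A maximal inequality for Markov chains\<close>

text \<open>
  Conditioning on an independent variable, in the form used for Markov chains: \<open>X\<close> will be the past
  and \<open>Y\<close> the next innovation. The joint law is a product, so this is Tonelli's theorem.
\<close>

lemma (in prob_space) nn_integral_indep_pair:
  assumes ind: "indep_var S X T Y" and f: "f \<in> borel_measurable (S \<Otimes>\<^sub>M T)"
  shows "(\<integral>\<^sup>+s. f (X s, Y s) \<partial>M) = (\<integral>\<^sup>+s. \<integral>\<^sup>+t. f (X s, Y t) \<partial>M \<partial>M)"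
proof -
  have X: "X \<in> measurable M S" and Y: "Y \<in> measurable M T"
    and joint: "distr M S X \<Otimes>\<^sub>M distr M T Y = distr M (S \<Otimes>\<^sub>M T) (\<lambda>x. (X x, Y x))"
    using ind unfolding indep_var_distribution_eq by auto
  interpret Y: prob_space "distr M T Y" using Y by (rule prob_space_distr)
  have f': "f \<in> borel_measurable (S \<Otimes>\<^sub>M distr M T Y)"
    using f by (simp cong: measurable_cong_sets sets_pair_measure_cong)
  have f'': "f \<in> borel_measurable (distr M S X \<Otimes>\<^sub>M distr M T Y)"
    using f by (simp cong: measurable_cong_sets sets_pair_measure_cong)
  have "(\<integral>\<^sup>+s. f (X s, Y s) \<partial>M) = integral\<^sup>N (distr M (S \<Otimes>\<^sub>M T) (\<lambda>x. (X x, Y x))) f"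
    using X Y f by (subst nn_integral_distr) auto
  also have "\<dots> = (\<integral>\<^sup>+x. \<integral>\<^sup>+y. f (x, y) \<partial>distr M T Y \<partial>distr M S X)"
    unfolding joint[symmetric] using f'' by (rule Y.nn_integral_fst[symmetric])
  also have "\<dots> = (\<integral>\<^sup>+s. \<integral>\<^sup>+y. f (X s, y) \<partial>distr M T Y \<partial>M)"
    using X Y.borel_measurable_nn_integral_fst[OF f'] by (subst nn_integral_distr) auto
  also have "\<dots> = (\<integral>\<^sup>+s. \<integral>\<^sup>+t. f (X s, Y t) \<partial>M \<partial>M)"
  proof (intro nn_integral_cong)
    fix s assume s: "s \<in> space M"
    have "(\<lambda>y. f (X s, y)) \<in> borel_measurable T"
      using f X s by (auto intro: measurable_compose_Pair1 measurable_space)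
    with Y show "(\<integral>\<^sup>+y. f (X s, y) \<partial>distr M T Y) = (\<integral>\<^sup>+t. f (X s, Y t) \<partial>M)"
      by (subst nn_integral_distr) auto
  qed
  finally show ?thesis .
qed

lemma measurable_chain:
  assumes F: "case_prod F \<in> borel_measurable borel"
    and \<omega>: "\<And>k. \<omega> k \<in> borel_measurable M"
  shows "chain F \<omega> x0 k \<in> borel_measurable M"
proof (induction k)
  case (Suc k)
  have F': "case_prod F \<in> borel_measurable (borel \<Otimes>\<^sub>M borel)" using F by (simp add: borel_prod)
  note Suc[measurable] \<omega>[measurable]
  have "(\<lambda>s. case_prod F (chain F \<omega> x0 k s, \<omega> k s)) \<in> borel_measurable M"
    by (rule measurable_compose[OF _ F']) measurable
  then show ?case by simp
qed simp

text \<open>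
  Taking the innovations to be the coordinate projections \<open>\<lambda>i h. h i\<close> turns the chain into a measurable
  function of the finite vector of its first \<open>n\<close> innovations. This exhibits the position at time
  \<open>k \<le> n\<close> as a function of variables that are independent of the innovation \<open>\<omega> n\<close>.
\<close>

lemma chain_history:
  "k \<le> n \<Longrightarrow> chain F \<omega> x0 k s = chain F (\<lambda>i h. h i) x0 k (\<lambda>i\<in>{..<n}. \<omega> i s)"
  by (induction k) auto

lemma measurable_chain_history:
  assumes F: "case_prod F \<in> borel_measurable borel"
  shows "k \<le> n \<Longrightarrow>
    chain F (\<lambda>i h. h i) x0 k \<in> borel_measurable (PiM {..<n} (\<lambda>_. borel))"
proof (induction k)
  case 0
  then show ?case by simp
next
  case (Suc k)
  have F': "case_prod F \<in> borel_measurable (borel \<Otimes>\<^sub>M borel)" using F by (simp add: borel_prod)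
  have [measurable]: "chain F (\<lambda>i h. h i) x0 k \<in> borel_measurable (PiM {..<n} (\<lambda>_. borel))"
    using Suc by simp
  have [measurable]: "(\<lambda>h. h k) \<in> borel_measurable (PiM {..<n} (\<lambda>_. borel))"
    using Suc.prems by (intro measurable_component_singleton) auto
  have "(\<lambda>h. case_prod F (chain F (\<lambda>i h. h i) x0 k h, h k))
     \<in> borel_measurable (PiM {..<n} (\<lambda>_. borel))"
    by (rule measurable_compose[OF _ F']) measurable
  then show ?case by simp
qed

text \<open>
  A form of Ville's maximal inequality in which the drift condition is required only inside the
  region \<open>V k x < 1\<close>. Freeze the process at the value \<open>1\<close> from the first exit of the region on; the
  expectation \<open>E n\<close> of the frozen process at time \<open>n\<close> is nonincreasing in \<open>n\<close> by the drift condition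
  and independence, starts at or below \<open>V 0 x0\<close>, and dominates the probability of having left the
  region by time \<open>n\<close>. Restricting the drift condition to the region is what makes the inequality
  applicable below, since there the chain is automatically far from the origin, and only far
  from the origin is its dynamics known.
\<close>

lemma (in prob_space) chain_maximal_inequality:
  fixes V :: "nat \<Rightarrow> real \<Rightarrow> ennreal"
  assumes indep: "indep_vars (\<lambda>_. borel) \<omega> UNIV"
    and F: "case_prod F \<in> borel_measurable borel"
    and V: "\<And>k. V k \<in> borel_measurable borel"
    and drift: "\<And>k x. V k x < 1 \<Longrightarrow> (\<integral>\<^sup>+s. V (Suc k) (F x (\<omega> k s)) \<partial>M) \<le> V k x"
  shows "{s\<in>space M. \<exists>k. 1 \<le> V k (chain F \<omega> x0 k s)} \<in> events"
    and "emeasure M {s\<in>space M. \<exists>k. 1 \<le> V k (chain F \<omega> x0 k s)} \<le> V 0 x0"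
proof -
  define X where "X k s = chain F \<omega> x0 k s" for k s
  define H where "H n s = (\<lambda>i\<in>{..<n}. \<omega> i s)" for n s
  define Y where "Y = chain F (\<lambda>i h. h i) x0"
  define PH where "PH n = PiM {..<n} (\<lambda>_. borel :: real measure)" for n :: nat
  have [measurable]: "\<And>k. \<omega> k \<in> borel_measurable M"
    using indep by (auto simp: indep_vars_def)
  have H[measurable]: "H n \<in> measurable M (PH n)" for n
    unfolding H_def PH_def by measurable
  have Y: "Y k \<in> borel_measurable (PH n)" if "k \<le> n" for k n
    using measurable_chain_history[OF F that] by (simp add: Y_def PH_def)
  have XY: "X k s = Y k (H n s)" if "k \<le> n" for k n s
    using chain_history[OF that, of F \<omega> x0 s] by (simp add: X_def Y_def H_def)
  have X[measurable]: "X k \<in> borel_measurable M" for k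
    unfolding X_def[abs_def] by (rule measurable_chain[OF F]) simp
  note V[measurable]
  \<comment> \<open>\<open>N n\<close> says that no exit has occurred up to and including time \<open>n\<close>, as a property of the history.\<close>
  define N where "N n h \<longleftrightarrow> (\<forall>j\<le>n. V j (Y j h) < 1)" for n h
  have N[measurable]: "Measurable.pred (PH n) (N n)" for n
  proof -
    have "Measurable.pred (PH n) (\<lambda>h. \<forall>j\<in>{..n}. V j (Y j h) < 1)"
    proof (rule pred_intros_finite(3))
      fix j assume "j \<in> {..n}"
      then have [measurable]: "Y j \<in> borel_measurable (PH n)" by (intro Y) auto
      show "Measurable.pred (PH n) (\<lambda>h. V j (Y j h) < 1)" by measurable
    qed simp
    also have "(\<lambda>h. \<forall>j\<in>{..n}. V j (Y j h) < 1) = N n"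
      by (auto simp: N_def fun_eq_iff)
    finally show ?thesis .
  qed
  have F'[measurable]: "case_prod F \<in> borel_measurable (borel \<Otimes>\<^sub>M borel)"
    using F by (simp add: borel_prod)
  have NX: "N n (H n s) \<longleftrightarrow> (\<forall>j\<le>n. V j (X j s) < 1)" for n s
    using XY[of _ n s] by (auto simp: N_def)
  define E where "E n = (\<integral>\<^sup>+s. (if N n (H n s) then V n (X n s) else 1) \<partial>M)" for n
  have E0: "E 0 \<le> V 0 x0"
  proof -
    have "E 0 \<le> (\<integral>\<^sup>+s. V 0 x0 \<partial>M)"
      unfolding E_def NX by (intro nn_integral_mono) (auto simp: X_def not_less)
    then show ?thesis by (simp add: emeasure_space_1)
  qed
  have ESuc: "E (Suc n) \<le> E n" for n
  proof -
    \<comment> \<open>The frozen process after one more step, without a second test for exit: an upper bound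
      for the integrand of \<open>E (Suc n)\<close>, because at an exit \<open>V\<close> is at least \<open>1\<close>.\<close>
    define g where "g = (\<lambda>(h, w). if N n h then V (Suc n) (F (Y n h) (w n)) else 1)"
    \<comment> \<open>Independence of two variables is formulated for a common value type, so the new innovation
      is packaged as a vector indexed by \<open>{n}\<close>.\<close>
    define P1 where "P1 = PiM {n} (\<lambda>_. borel :: real measure)"
    have [measurable]: "(\<lambda>w. w n) \<in> borel_measurable P1"
      unfolding P1_def by (rule measurable_component_singleton) simp
    have Yn[measurable]: "Y n \<in> borel_measurable (PH n)" by (rule Y) simp
    have "(\<lambda>p. case_prod F (Y n (fst p), snd p n)) \<in> borel_measurable (PH n \<Otimes>\<^sub>M P1)"
      by (rule measurable_compose[OF _ F']) measurable
    then have [measurable]: "(\<lambda>p. F (Y n (fst p)) (snd p n)) \<in> borel_measurable (PH n \<Otimes>\<^sub>M P1)"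
      by simp
    have g: "g \<in> borel_measurable (PH n \<Otimes>\<^sub>M P1)"
      unfolding g_def case_prod_beta by measurable
    have ind: "indep_var (PH n) (H n) P1 (\<lambda>s. \<lambda>i\<in>{n}. \<omega> i s)"
      unfolding H_def[abs_def] PH_def P1_def using indep by (rule indep_var_restrict) auto
    have "E (Suc n) \<le> (\<integral>\<^sup>+s. g (H n s, \<lambda>i\<in>{n}. \<omega> i s) \<partial>M)"
      unfolding E_def
    proof (intro nn_integral_mono)
      fix s
      have "N (Suc n) (H (Suc n) s) \<Longrightarrow> N n (H n s)"
        by (auto simp: NX)
      moreover have "\<not> N (Suc n) (H (Suc n) s) \<Longrightarrow> N n (H n s) \<Longrightarrow> 1 \<le> V (Suc n) (X (Suc n) s)"
        by (auto simp: NX le_Suc_eq not_less)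
      moreover have "F (Y n (H n s)) (\<omega> n s) = X (Suc n) s"
        using XY[of n n s] by (simp add: X_def)
      ultimately show "(if N (Suc n) (H (Suc n) s) then V (Suc n) (X (Suc n) s) else 1)
          \<le> g (H n s, \<lambda>i\<in>{n}. \<omega> i s)"
        by (auto simp: g_def)
    qed
    also have "\<dots> = (\<integral>\<^sup>+s. \<integral>\<^sup>+t. g (H n s, \<lambda>i\<in>{n}. \<omega> i t) \<partial>M \<partial>M)"
      by (rule nn_integral_indep_pair[OF ind g])
    also have "\<dots> \<le> E n"
      unfolding E_def
    proof (intro nn_integral_mono)
      fix s
      have "Y n (H n s) = X n s" using XY[of n n s] by simp
      then show "(\<integral>\<^sup>+t. g (H n s, \<lambda>i\<in>{n}. \<omega> i t) \<partial>M)
          \<le> (if N n (H n s) then V n (X n s) else 1)"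
        using drift[of n "X n s"] NX[of n s]
        by (cases "N n (H n s)") (simp_all add: g_def emeasure_space_1)
    qed
    finally show ?thesis .
  qed
  have En: "E n \<le> V 0 x0" for n
    using E0 ESuc by (induction n) (auto intro: order_trans)
  define B where "B n = {s\<in>space M. \<not> N n (H n s)}" for n
  have B[measurable]: "B n \<in> events" for n
    unfolding B_def by measurable
  have emB: "emeasure M (B n) \<le> V 0 x0" for n
  proof -
    have "emeasure M (B n) = (\<integral>\<^sup>+s. indicator (B n) s \<partial>M)" using B by simp
    also have "\<dots> \<le> E n"
      unfolding E_def by (intro nn_integral_mono) (auto simp: B_def indicator_def)
    finally show ?thesis using En order_trans by blast
  qed
  have UB: "{s\<in>space M. \<exists>k. 1 \<le> V k (chain F \<omega> x0 k s)} = (\<Union>n. B n)"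
    by (auto simp: B_def NX X_def not_less)
  show "{s\<in>space M. \<exists>k. 1 \<le> V k (chain F \<omega> x0 k s)} \<in> events"
    unfolding UB by auto
  have "N (Suc n) (H (Suc n) s) \<Longrightarrow> N n (H n s)" for n s
    by (auto simp: NX)
  then have "incseq B"
    by (intro incseq_SucI) (auto simp: B_def)
  then have "emeasure M (\<Union>n. B n) = (SUP n. emeasure M (B n))"
    by (intro SUP_emeasure_incseq[symmetric]) auto
  also have "\<dots> \<le> V 0 x0"
    by (rule SUP_least) (rule emB)
  finally show "emeasure M {s\<in>space M. \<exists>k. 1 \<le> V k (chain F \<omega> x0 k s)} \<le> V 0 x0"
    unfolding UB .
qed

section \<open>Power functions and the drift of the barrier\<close>

text \<open>
  Second-order Taylor bound at \<open>0\<close>. The slack \<open>\<eta>\<close> absorbs the remainder, so that only first and second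
  moments of the increments enter the drift of \<open>x powr (-a)\<close>.
\<close>

lemma one_plus_powr_neg_le_quadratic:
  fixes a \<eta> :: real
  assumes "0 < a" "0 < \<eta>"
  shows "\<exists>r>0. r < 1 \<and> (\<forall>u. \<bar>u\<bar> \<le> r \<longrightarrow>
    (1 + u) powr (-a) \<le> 1 - a * u + (a * (a + 1) / 2 + \<eta>) * u\<^sup>2)"
proof -
  have "((\<lambda>u::real. ((1 + u) powr (-a) - 1 + a * u) / u\<^sup>2) \<longlongrightarrow> a * (a + 1) / 2) (at 0)"
    using \<open>0 < a\<close> by (real_asymp simp: field_simps)
  then have "\<forall>\<^sub>F u in at 0. ((1 + u) powr (-a) - 1 + a * u) / u\<^sup>2 < a * (a + 1) / 2 + \<eta>"
    using \<open>0 < \<eta>\<close> by (intro order_tendstoD(2)) auto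
  then obtain r where r: "0 < r" and
    small: "\<And>u. u \<noteq> 0 \<Longrightarrow> \<bar>u\<bar> < r \<Longrightarrow>
      ((1 + u) powr (-a) - 1 + a * u) / u\<^sup>2 < a * (a + 1) / 2 + \<eta>"
    unfolding eventually_at by (auto simp: dist_real_def)
  show ?thesis
  proof (intro exI[of _ "min (r/2) (1/2)"] conjI allI impI)
    fix u assume u: "\<bar>u\<bar> \<le> min (r/2) (1/2)"
    show "(1 + u) powr (-a) \<le> 1 - a * u + (a * (a + 1) / 2 + \<eta>) * u\<^sup>2"
    proof (cases "u = 0")
      case False
      with small[of u] u r show ?thesis by (simp add: pos_divide_less_eq)
    qed simp
  qed (use r in auto)
qed

lemma powr_plus_one_minus_powr:
  fixes t p :: real
  assumes "0 < t"
  shows "\<exists>z. t < z \<and> z < t + 1 \<and> (t + 1) powr p - t powr p = p * z powr (p - 1)"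
proof -
  have "\<exists>z. t < z \<and> z < t + 1 \<and>
      (t + 1) powr p - t powr p = (t + 1 - t) * (p * z powr (p - 1))"
    using assms by (intro MVT2) (auto intro!: derivative_eq_intros simp: powr_diff)
  then show ?thesis by simp
qed

lemma powr_plus_one_le:
  fixes t b :: real
  assumes "0 < t" "0 \<le> b" "b \<le> 1"
  shows "(t + 1) powr b \<le> t powr b * (1 + b / t)"
proof -
  obtain z where z: "t < z" "(t + 1) powr b - t powr b = b * z powr (b - 1)"
    using powr_plus_one_minus_powr[OF assms(1)] by blast
  have "b * z powr (b - 1) \<le> b * t powr (b - 1)"
    using assms z by (intro mult_left_mono powr_mono2') auto
  with z assms show ?thesis by (simp add: powr_diff algebra_simps)
qed

lemma powr_neg_decrement_ge:
  fixes t d :: real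
  assumes "0 < t" "0 < d"
  shows "d * (t + 1) powr (-d - 1) \<le> t powr (-d) - (t + 1) powr (-d)"
proof -
  obtain z where z: "t < z" "z < t + 1" "(t + 1) powr (-d) - t powr (-d) = (-d) * z powr (-d - 1)"
    using powr_plus_one_minus_powr[OF assms(1)] by blast
  have "d * (t + 1) powr (-d - 1) \<le> d * z powr (-d - 1)"
    using assms z by (intro mult_left_mono powr_mono2') auto
  with z show ?thesis by simp
qed

text \<open>
  The mean of the squared position grows by at most \<open>C\<close> per step. Dividing by \<open>t powr (\<nu> + 1)\<close> makes
  the resulting excess summable, and it is paid for by the decrease of the term \<open>C / \<nu> * t powr (-\<nu>)\<close>.
\<close>

lemma quadratic_term_drift:
  fixes t x C \<nu> :: real
  assumes "0 < t" "0 < \<nu>" "0 \<le> C"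
  shows "(t + 1) powr (-\<nu> - 1) * (x\<^sup>2 + C)
    \<le> t powr (-\<nu> - 1) * x\<^sup>2 + C / \<nu> * (t powr (-\<nu>) - (t + 1) powr (-\<nu>))"
proof -
  have "(t + 1) powr (-\<nu> - 1) * x\<^sup>2 \<le> t powr (-\<nu> - 1) * x\<^sup>2"
    using assms by (intro mult_right_mono powr_mono2') auto
  moreover have "C / \<nu> * (\<nu> * (t + 1) powr (-\<nu> - 1)) \<le> C / \<nu> * (t powr (-\<nu>) - (t + 1) powr (-\<nu>))"
    using assms by (intro mult_left_mono powr_neg_decrement_ge) auto
  ultimately show ?thesis using assms by (simp add: algebra_simps)
qed

text \<open>
  The factor \<open>t powr b\<close> increases by a relative amount of at most \<open>b / t\<close>, while the drift of
  \<open>x powr (-a)\<close> is a relative decrease by \<open>c / x\<^sup>2\<close>. The decrease wins when \<open>x\<^sup>2\<close> is at most a multiple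
  of \<open>t\<close>. For larger \<open>x\<close> the product \<open>t powr b * x powr (-a)\<close> is at most of order \<open>t powr (-d)\<close>, its increase
  at most of order \<open>t powr (-d - 1)\<close>, and the decreasing term \<open>D * t powr (-d)\<close> compensates for it.
\<close>

lemma negative_power_term_drift:
  fixes a c b d :: real
  assumes "0 < b" "b \<le> 1" "0 < d" "a = 2 * (b + d)" "0 < c"
  shows "\<exists>D\<ge>0. \<forall>t\<ge>1. \<forall>x>0. (t + 1) powr b * (x powr (-a) * (1 - c / x\<^sup>2))
    \<le> t powr b * x powr (-a) + D * (t powr (-d) - (t + 1) powr (-d))"
proof -
  \<comment> \<open>\<open>K * t powr (-d - 1)\<close> bounds the increase in the far region; the factor \<open>2 powr (d + 1)\<close> in \<open>D\<close>
    comes from replacing \<open>t\<close> by \<open>t + 1\<close>, which is at most \<open>2 * t\<close>.\<close>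
  define K where "K = b * (c / b) powr (-a/2)"
  define D where "D = K * 2 powr (d + 1) / d"
  have K: "0 \<le> K" and D: "0 \<le> D"
    using assms by (auto simp: K_def D_def)
  have "(t + 1) powr b * (x powr (-a) * (1 - c / x\<^sup>2))
    \<le> t powr b * x powr (-a) + D * (t powr (-d) - (t + 1) powr (-d))"
    if t: "1 \<le> t" and x: "0 < x" for t x
  proof (cases "b / t \<le> c / x\<^sup>2")
    case True
    have u: "0 \<le> b / t" "b / t \<le> 1" using assms t by (auto simp: divide_le_eq_1)
    have "(t + 1) powr b * (x powr (-a) * (1 - c / x\<^sup>2)) \<le> (t + 1) powr b * (x powr (-a) * (1 - b / t))"
      using True by (intro mult_left_mono) auto
    also have "\<dots> \<le> (t powr b * (1 + b / t)) * (x powr (-a) * (1 - b / t))"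
      using assms t u by (intro mult_right_mono powr_plus_one_le) auto
    also have "\<dots> = t powr b * x powr (-a) * (1 - (b / t)\<^sup>2)"
      by (simp add: algebra_simps power2_eq_square)
    also have "\<dots> \<le> t powr b * x powr (-a) * 1"
      by (intro mult_left_mono) auto
    also have "\<dots> \<le> t powr b * x powr (-a) + D * (t powr (-d) - (t + 1) powr (-d))"
      using D assms t by (auto intro!: mult_nonneg_nonneg powr_mono2')
    finally show ?thesis .
  next
    case False
    then have "c / b * t \<le> x\<^sup>2"
      using assms t x by (simp add: field_simps)
    then have "(x\<^sup>2) powr (-a/2) \<le> (c / b * t) powr (-a/2)"
      using assms t by (intro powr_mono2') auto
    moreover have "(x\<^sup>2) powr (-a/2) = x powr (-a)"
      using x by (simp add: powr_powr flip: powr_numeral)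
    ultimately have xa: "x powr (-a) \<le> (c / b) powr (-a/2) * t powr (-a/2)"
      using powr_mult[of "c / b" t "-a/2"] assms(1,5) t by simp
    have neg_powr: "u powr (-d - 1) = 1 / u powr (d + 1)" for u :: real
      using powr_minus_divide[of u "d + 1"] by simp
    have "t powr (-d - 1) = (1 / t) powr (d + 1)"
      using t by (simp add: powr_divide neg_powr)
    also have "\<dots> \<le> (2 / (t + 1)) powr (d + 1)"
      using assms t by (intro powr_mono2) (auto simp: field_simps)
    also have "\<dots> = 2 powr (d + 1) * (t + 1) powr (-d - 1)"
      using t by (simp add: powr_divide neg_powr)
    finally have t1: "t powr (-d - 1) \<le> 2 powr (d + 1) * (t + 1) powr (-d - 1)" .
    have "(t + 1) powr b * (x powr (-a) * (1 - c / x\<^sup>2)) \<le> (t + 1) powr b * (x powr (-a) * 1)"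
      using assms by (intro mult_left_mono) auto
    also have "\<dots> \<le> (t powr b * (1 + b / t)) * (x powr (-a) * 1)"
      using assms t by (intro mult_right_mono powr_plus_one_le) auto
    also have "\<dots> = t powr b * x powr (-a) + b / t * t powr b * x powr (-a)"
      by (simp add: algebra_simps)
    also have "b / t * t powr b * x powr (-a) \<le> b / t * t powr b * ((c / b) powr (-a/2) * t powr (-a/2))"
      using xa assms t by (intro mult_left_mono) auto
    also have "\<dots> = K * (t powr b * t powr (-a/2) / t)"
      by (simp add: K_def)
    also have "t powr b * t powr (-a/2) / t = t powr (-d - 1)"
    proof -
      have "b + -a/2 = -d" using assms(4) by (simp add: field_simps)
      then have "t powr b * t powr (-a/2) = t powr (-d)" by (simp only: powr_add[symmetric])
      then show ?thesis using t by (simp add: powr_diff)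
    qed
    also have "K * \<dots> \<le> K * (2 powr (d + 1) * (t + 1) powr (-d - 1))"
      using t1 K by (intro mult_left_mono)
    also have "\<dots> = D * (d * (t + 1) powr (-d - 1))"
      using assms by (simp add: D_def)
    also have "\<dots> \<le> D * (t powr (-d) - (t + 1) powr (-d))"
      using D assms t by (intro mult_left_mono powr_neg_decrement_ge) auto
    finally show ?thesis by simp
  qed
  with D show ?thesis by blast
qed

text \<open>
  The time-dependent Lyapunov function. Its first two summands become large when the position \<open>x\<close> at
  time \<open>t\<close> is too small or too large compared with \<open>sqrt t\<close>; the last two depend on time only and
  turn the sum into a supermartingale as long as the chain is far from the origin.
\<close>

definition barrier :: "real \<Rightarrow> real \<Rightarrow> real \<Rightarrow> real \<Rightarrow> real \<Rightarrow> real \<Rightarrow> real" where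
  "barrier a \<nu> D1 D2 t x = t powr (a * (1 - \<nu>) / 2) * x powr (-a) + t powr (-\<nu> - 1) * x\<^sup>2
     + D1 * t powr (-\<nu>) + D2 * t powr (-(a * \<nu> / 2))"

lemma (in prob_space) integrable_bounded:
  fixes Z :: "'a \<Rightarrow> real"
  assumes [measurable]: "Z \<in> borel_measurable M" and bound: "\<forall>s\<in>space M. \<bar>Z s\<bar> \<le> B"
  shows "integrable M Z" "integrable M (\<lambda>s. (Z s)\<^sup>2)"
proof -
  show "integrable M Z"
    using bound by (intro integrable_const_bound[where B=B]) auto
  have "\<bar>(Z s)\<^sup>2\<bar> \<le> B\<^sup>2" if "s \<in> space M" for s
    using power_mono[of "\<bar>Z s\<bar>" B 2] bound that by auto
  then show "integrable M (\<lambda>s. (Z s)\<^sup>2)"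
    by (intro integrable_const_bound[where B="B\<^sup>2"]) auto
qed

text \<open>
  \<open>Y x\<close> is the random increment of a chain that sits at \<open>x\<close>. The asymptotic conditions on its moments
  are those of Lamperti's problem: mean \<open>\<gamma> / x\<close> and variance \<open>1\<close> to leading order. The critical drift
  is \<open>\<gamma> = 1/2\<close>, above which the chain is transient.
\<close>

locale lamperti_increments = prob_space +
  fixes Y :: "real \<Rightarrow> 'a \<Rightarrow> real" and \<gamma> H :: real
  assumes measurable_increment[measurable]: "\<And>x. Y x \<in> borel_measurable M"
    and increment_bounded: "\<forall>\<^sub>F x in at_top. \<forall>s\<in>space M. \<bar>Y x s\<bar> \<le> H"
    and first_moment: "((\<lambda>x. x * expectation (Y x)) \<longlongrightarrow> \<gamma>) at_top"
    and second_moment: "((\<lambda>x. expectation (\<lambda>s. (Y x s)\<^sup>2)) \<longlongrightarrow> 1) at_top"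
begin

lemma eventually_square_drift:
  "\<forall>\<^sub>F x in at_top. integrable M (\<lambda>s. (x + Y x s)\<^sup>2) \<and>
     expectation (\<lambda>s. (x + Y x s)\<^sup>2) \<le> x\<^sup>2 + (2 * \<gamma> + 2)"
proof -
  have "\<forall>\<^sub>F x in at_top. x * expectation (Y x) < \<gamma> + 1/4"
    using first_moment by (rule order_tendstoD) simp
  moreover have "\<forall>\<^sub>F x in at_top. expectation (\<lambda>s. (Y x s)\<^sup>2) < 3/2"
    using second_moment by (rule order_tendstoD) simp
  ultimately show ?thesis
    using increment_bounded
  proof eventually_elim
    case (elim x)
    note int = integrable_bounded[OF measurable_increment elim(3)]
    have eq: "(\<lambda>s. (x + Y x s)\<^sup>2) = (\<lambda>s. x\<^sup>2 + 2 * x * Y x s + (Y x s)\<^sup>2)"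
      by (simp add: power2_sum algebra_simps)
    show ?case
      unfolding eq using int elim by (simp add: prob_space)
  qed
qed

text \<open>
  To leading order the relative drift of \<open>x powr (-a)\<close> is \<open>- a * (\<gamma> - (a + 1) / 2) / x\<^sup>2\<close>, by the Taylor
  expansion. It is negative as soon as \<open>a + 1 < 2 * \<gamma>\<close>, and a positive \<open>a\<close> of this kind exists exactly
  when \<open>\<gamma>\<close> exceeds \<open>1/2\<close>.
\<close>

lemma eventually_negative_power_drift:
  assumes a: "0 < a" "a + 1 < 2 * \<gamma>"
  shows "\<exists>c>0. \<forall>\<^sub>F x in at_top. integrable M (\<lambda>s. (x + Y x s) powr (-a)) \<and>
    expectation (\<lambda>s. (x + Y x s) powr (-a)) \<le> x powr (-a) * (1 - c / x\<^sup>2)"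
proof -
  \<comment> \<open>Half of the available margin: the limit of \<open>L\<close> below is \<open>- 2 * \<eta> + \<eta>\<close>.\<close>
  define \<eta> where "\<eta> = a * (\<gamma> - (a + 1) / 2) / 2"
  have \<eta>: "0 < \<eta>" using a by (simp add: \<eta>_def)
  define q where "q = a * (a + 1) / 2 + \<eta>"
  obtain r where r: "0 < r" "r < 1"
    and quad: "\<And>u. \<bar>u\<bar> \<le> r \<Longrightarrow> (1 + u) powr (-a) \<le> 1 - a * u + q * u\<^sup>2"
    using one_plus_powr_neg_le_quadratic[OF a(1) \<eta>] unfolding q_def by blast
  define L where "L x = - a * (x * expectation (Y x)) + q * expectation (\<lambda>s. (Y x s)\<^sup>2)" for x
  have "(L \<longlongrightarrow> - a * \<gamma> + q * 1) at_top"
    unfolding L_def[abs_def] by (intro tendsto_intros first_moment second_moment)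
  moreover have "- a * \<gamma> + q * 1 = - \<eta>"
    by (simp add: q_def \<eta>_def field_simps)
  then have "- a * \<gamma> + q * 1 < - (\<eta> / 2)"
    using \<eta> by simp
  ultimately have "\<forall>\<^sub>F x in at_top. L x < - (\<eta> / 2)"
    by (rule order_tendstoD)
  moreover have "\<forall>\<^sub>F x in at_top. max 1 (H / r) < x"
    by (rule eventually_gt_at_top)
  ultimately have "\<forall>\<^sub>F x in at_top. integrable M (\<lambda>s. (x + Y x s) powr (-a)) \<and>
    expectation (\<lambda>s. (x + Y x s) powr (-a)) \<le> x powr (-a) * (1 - (\<eta> / 2) / x\<^sup>2)"
    using increment_bounded
  proof eventually_elim
    case (elim x)
    then have x: "0 < x" "H < r * x" using r by (auto simp: field_simps)
    note int = integrable_bounded[OF measurable_increment elim(3)]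
    have small: "\<bar>Y x s / x\<bar> \<le> r" if "s \<in> space M" for s
      using elim(3) that x by (auto simp: field_simps abs_divide intro: order_trans)
    have pw: "(x + Y x s) powr (-a)
        \<le> x powr (-a) * (1 - a / x * Y x s + q / x\<^sup>2 * (Y x s)\<^sup>2)" if "s \<in> space M" for s
    proof -
      have "x + Y x s = x * (1 + Y x s / x)" using x by (simp add: field_simps)
      moreover have "0 \<le> 1 + Y x s / x" using small[OF that] r by (simp add: abs_le_iff del: abs_divide)
      ultimately have "(x + Y x s) powr (-a) = x powr (-a) * (1 + Y x s / x) powr (-a)"
        using x by (simp add: powr_mult)
      also have "\<dots> \<le> x powr (-a) * (1 - a * (Y x s / x) + q * (Y x s / x)\<^sup>2)"
        using small[OF that] by (intro mult_left_mono quad) auto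
      finally show ?thesis by (simp add: power_divide)
    qed
    have int_bound: "integrable M (\<lambda>s. x powr (-a) * (1 - a / x * Y x s + q / x\<^sup>2 * (Y x s)\<^sup>2))"
      using int by simp
    have int_powr: "integrable M (\<lambda>s. (x + Y x s) powr (-a))"
    proof (rule Bochner_Integration.integrable_bound[OF int_bound])
      show "AE s in M. norm ((x + Y x s) powr (-a))
          \<le> norm (x powr (-a) * (1 - a / x * Y x s + q / x\<^sup>2 * (Y x s)\<^sup>2))"
        using pw by (intro AE_I2) (force intro: order_trans[OF _ abs_ge_self])
    qed measurable
    have "expectation (\<lambda>s. (x + Y x s) powr (-a))
        \<le> expectation (\<lambda>s. x powr (-a) * (1 - a / x * Y x s + q / x\<^sup>2 * (Y x s)\<^sup>2))"
      using int_powr int_bound pw by (rule integral_mono)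
    also have "\<dots> = x powr (-a) * (1 + L x / x\<^sup>2)"
      using int x by (simp add: prob_space L_def) (simp add: field_simps power2_eq_square)
    also have "\<dots> \<le> x powr (-a) * (1 - (\<eta> / 2) / x\<^sup>2)"
    proof (intro mult_left_mono)
      have "L x / x\<^sup>2 \<le> - (\<eta> / 2) / x\<^sup>2"
        using elim(1) by (intro divide_right_mono) auto
      then show "1 + L x / x\<^sup>2 \<le> 1 - (\<eta> / 2) / x\<^sup>2" by simp
    qed simp
    finally show ?case using int_powr by simp
  qed
  then show ?thesis using \<eta> by (intro exI[of _ "\<eta>/2"]) simp
qed

lemma barrier_drift:
  assumes \<gamma>: "1 < 2 * \<gamma>" and \<nu>: "0 < \<nu>" "\<nu> < 1"
  shows "\<exists>a D1 D2. 0 < a \<and> 0 \<le> D1 \<and> 0 \<le> D2 \<and>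
    (\<forall>\<^sub>F x in at_top. \<forall>t\<ge>1.
      (\<integral>\<^sup>+s. ennreal (barrier a \<nu> D1 D2 (t + 1) (x + Y x s)) \<partial>M)
        \<le> ennreal (barrier a \<nu> D1 D2 t x))"
proof -
  \<comment> \<open>The cap at \<open>1\<close> keeps the exponent \<open>b\<close> of time below \<open>1\<close>, as Bernoulli's inequality requires.\<close>
  define a where "a = min 1 (\<gamma> - 1/2)"
  have a: "0 < a" "a \<le> 1" "a + 1 < 2 * \<gamma>" using \<gamma> by (auto simp: a_def)
  define b where "b = a * (1 - \<nu>) / 2"
  define d where "d = a * \<nu> / 2"
  have "a * (1 - \<nu>) \<le> 1 * 1" using a \<nu> by (intro mult_mono) auto
  then have bd: "0 < b" "b \<le> 1" "0 < d" "a = 2 * (b + d)"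
    using a \<nu> by (auto simp: b_def d_def field_simps)
  obtain c where c: "0 < c" and neg: "\<forall>\<^sub>F x in at_top. integrable M (\<lambda>s. (x + Y x s) powr (-a)) \<and>
    expectation (\<lambda>s. (x + Y x s) powr (-a)) \<le> x powr (-a) * (1 - c / x\<^sup>2)"
    using eventually_negative_power_drift[OF a(1,3)] by blast
  obtain D2 where D2: "0 \<le> D2" and step2: "\<And>t x. 1 \<le> t \<Longrightarrow> 0 < x \<Longrightarrow>
      (t + 1) powr b * (x powr (-a) * (1 - c / x\<^sup>2))
      \<le> t powr b * x powr (-a) + D2 * (t powr (-d) - (t + 1) powr (-d))"
    using negative_power_term_drift[OF bd c] by blast
  define C where "C = 2 * \<gamma> + 2"
  define D1 where "D1 = C / \<nu>"
  have CD: "0 \<le> C" "0 \<le> D1" using \<gamma> \<nu> by (auto simp: C_def D1_def)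
  have "\<forall>\<^sub>F x in at_top. \<forall>t\<ge>1.
      (\<integral>\<^sup>+s. ennreal (barrier a \<nu> D1 D2 (t + 1) (x + Y x s)) \<partial>M)
        \<le> ennreal (barrier a \<nu> D1 D2 t x)"
    using neg eventually_square_drift eventually_gt_at_top[of 0]
  proof eventually_elim
    case (elim x)
    show ?case
    proof (intro allI impI)
      fix t :: real assume t: "1 \<le> t"
      define T where "T = D1 * (t + 1) powr (-\<nu>) + D2 * (t + 1) powr (-d)"
      have eq: "barrier a \<nu> D1 D2 (t + 1) (x + Y x s) = (t + 1) powr b * (x + Y x s) powr (-a)
          + (t + 1) powr (-\<nu> - 1) * (x + Y x s)\<^sup>2 + T" for s
        by (simp add: barrier_def b_def d_def T_def)
      have "(\<integral>\<^sup>+s. ennreal (barrier a \<nu> D1 D2 (t + 1) (x + Y x s)) \<partial>M)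
          = ennreal (expectation (\<lambda>s. barrier a \<nu> D1 D2 (t + 1) (x + Y x s)))"
        using elim CD D2 unfolding eq T_def by (intro nn_integral_eq_integral) auto
      also have "expectation (\<lambda>s. barrier a \<nu> D1 D2 (t + 1) (x + Y x s))
          = (t + 1) powr b * expectation (\<lambda>s. (x + Y x s) powr (-a))
          + (t + 1) powr (-\<nu> - 1) * expectation (\<lambda>s. (x + Y x s)\<^sup>2) + T"
        using elim unfolding eq by (simp add: prob_space)
      also have "\<dots> \<le> (t + 1) powr b * (x powr (-a) * (1 - c / x\<^sup>2))
          + (t + 1) powr (-\<nu> - 1) * (x\<^sup>2 + C) + T"
        using elim unfolding C_def by (intro add_mono mult_left_mono) auto
      also have "\<dots> \<le> (t powr b * x powr (-a) + D2 * (t powr (-d) - (t + 1) powr (-d)))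
          + (t powr (-\<nu> - 1) * x\<^sup>2 + D1 * (t powr (-\<nu>) - (t + 1) powr (-\<nu>))) + T"
        using t elim CD \<nu> unfolding D1_def
        by (intro add_mono order_refl step2 quadratic_term_drift) auto
      also have "\<dots> = barrier a \<nu> D1 D2 t x"
        by (simp add: barrier_def b_def d_def T_def algebra_simps)
      finally show "(\<integral>\<^sup>+s. ennreal (barrier a \<nu> D1 D2 (t + 1) (x + Y x s)) \<partial>M)
          \<le> ennreal (barrier a \<nu> D1 D2 t x)"
        by (simp add: ennreal_leI)
    qed
  qed
  with a CD D2 show ?thesis by blast
qed

end

section \<open>From the expansion of the map to the moments of the increments\<close>

lemma sup_bigo_bound:
  assumes "sup_bigo S G g"
  obtains C where "0 < C" "\<forall>\<^sub>F x in at_top. \<forall>w\<in>S. \<bar>G x w\<bar> \<le> C * \<bar>g x\<bar>"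
proof -
  have bdd: "\<forall>\<^sub>F x in at_top. bdd_above ((\<lambda>w. \<bar>G x w\<bar>) ` S)"
    and O: "(\<lambda>x. SUP w\<in>S. \<bar>G x w\<bar>) \<in> O[at_top](g)"
    using assms by (auto simp: sup_bigo_def)
  from O obtain C where C: "0 < C" "\<forall>\<^sub>F x in at_top. norm (SUP w\<in>S. \<bar>G x w\<bar>) \<le> C * norm (g x)"
    by (rule landau_o.bigE)
  have "\<forall>\<^sub>F x in at_top. \<forall>w\<in>S. \<bar>G x w\<bar> \<le> C * \<bar>g x\<bar>"
    using bdd C(2)
  proof eventually_elim
    case (elim x)
    show ?case
    proof
      fix w assume "w \<in> S"
      then have "\<bar>G x w\<bar> \<le> (SUP w\<in>S. \<bar>G x w\<bar>)"
        using elim(1) by (intro cSUP_upper)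
      then show "\<bar>G x w\<bar> \<le> C * \<bar>g x\<bar>" using elim(2) by simp
    qed
  qed
  with C(1) show ?thesis by (rule that)
qed

lemma (in prob_space) abs_expectation_le:
  fixes Z :: "'a \<Rightarrow> real"
  assumes "integrable M Z" "\<And>s. s \<in> space M \<Longrightarrow> \<bar>Z s\<bar> \<le> B"
  shows "\<bar>expectation Z\<bar> \<le> B"
proof -
  have "\<bar>expectation Z\<bar> \<le> expectation (\<lambda>s. \<bar>Z s\<bar>)"
    by (rule integral_abs_bound)
  also have "\<dots> \<le> B"
    using assms by (intro integral_le_const AE_I2) auto
  finally show ?thesis .
qed

text \<open>
  The increment differs from \<open>W\<close> by at most some \<open>\<epsilon> x\<close> tending to \<open>0\<close>, uniformly in the noise, which
  settles boundedness and the second moment. The first moment must be known up to \<open>o(1/x)\<close>: there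
  \<open>W\<close> and \<open>G0\<close> vanish by averaging, however slowly \<open>G0\<close> decays, and \<open>\<beta> > 1\<close> makes the contribution
  of \<open>G1\<close> negligible.
\<close>

lemma (in prob_space) lamperti_increments_of_expansion:
  fixes W :: "'a \<Rightarrow> real" and F G0 G1 :: "real \<Rightarrow> real \<Rightarrow> real"
  assumes W[measurable]: "W \<in> borel_measurable M"
    and WB: "\<And>s. s \<in> space M \<Longrightarrow> \<bar>W s\<bar> \<le> B"
    and mean: "expectation W = 0" and var: "expectation (\<lambda>s. (W s)\<^sup>2) = 1"
    and F[measurable]: "\<And>x. F x \<in> borel_measurable borel"
    and \<alpha>: "0 < \<alpha>" and \<beta>: "1 < \<beta>"
    and expansion: "\<And>x w. x0 < x \<Longrightarrow> w \<in> {-B..B} \<Longrightarrow>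
      F x w = x + w + \<gamma> / x + G0 x w + G1 x w"
    and G0: "sup_bigo {-B..B} G0 (\<lambda>x. x powr (-\<alpha>))"
    and G1: "sup_bigo {-B..B} G1 (\<lambda>x. x powr (-\<beta>))"
    and G0_int: "\<And>x. x0 < x \<Longrightarrow> integrable M (\<lambda>s. G0 x (W s))"
    and G0_mean: "\<And>x. x0 < x \<Longrightarrow> expectation (\<lambda>s. G0 x (W s)) = 0"
  shows "lamperti_increments M (\<lambda>x s. F x (W s) - x) \<gamma> (B + 1)"
proof -
  define Y where "Y x s = F x (W s) - x" for x s
  obtain C0 where C0: "0 < C0" "\<forall>\<^sub>F x in at_top. \<forall>w\<in>{-B..B}. \<bar>G0 x w\<bar> \<le> C0 * \<bar>x powr (-\<alpha>)\<bar>"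
    using sup_bigo_bound[OF G0] .
  obtain C1 where C1: "0 < C1" "\<forall>\<^sub>F x in at_top. \<forall>w\<in>{-B..B}. \<bar>G1 x w\<bar> \<le> C1 * \<bar>x powr (-\<beta>)\<bar>"
    using sup_bigo_bound[OF G1] .
  define \<epsilon> where "\<epsilon> x = \<bar>\<gamma>\<bar> / x + C0 * x powr (-\<alpha>) + C1 * x powr (-\<beta>)" for x :: real
  have \<epsilon>0: "(\<epsilon> \<longlongrightarrow> 0) at_top"
  proof -
    have "(\<epsilon> \<longlongrightarrow> 0 + C0 * 0 + C1 * 0) at_top"
      unfolding \<epsilon>_def[abs_def] using \<alpha> \<beta>
      by (intro tendsto_intros tendsto_neg_powr filterlim_ident tendsto_divide_0[OF tendsto_const]
          filterlim_at_top_imp_at_infinity) auto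
    then show ?thesis by simp
  qed
  have Ymeas[measurable]: "Y x \<in> borel_measurable M" for x
    unfolding Y_def by measurable
  have WS: "s \<in> space M \<Longrightarrow> W s \<in> {-B..B}" for s
    using WB[of s] by auto
  have intW: "integrable M W" and intW2: "integrable M (\<lambda>s. (W s)\<^sup>2)"
    using WB by (auto intro: integrable_bounded[OF W])
  have "\<forall>\<^sub>F x in at_top. \<epsilon> x < 1"
    using \<epsilon>0 by (rule order_tendstoD) simp
  then have ev: "\<forall>\<^sub>F x in at_top. 0 < x \<and> x0 < x \<and> \<epsilon> x < 1 \<and>
      (\<forall>s\<in>space M. Y x s = W s + \<gamma> / x + G0 x (W s) + G1 x (W s) \<and>
         \<bar>Y x s - W s\<bar> \<le> \<epsilon> x \<and> \<bar>Y x s\<bar> \<le> B + 1 \<and> \<bar>G1 x (W s)\<bar> \<le> C1 * x powr (-\<beta>))"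
    using C0(2) C1(2) eventually_gt_at_top[of 0] eventually_gt_at_top[of x0]
  proof eventually_elim
    case (elim x)
    show ?case
    proof (intro conjI ballI)
      fix s assume s: "s \<in> space M"
      show Y: "Y x s = W s + \<gamma> / x + G0 x (W s) + G1 x (W s)"
        using expansion[OF elim(5) WS[OF s]] by (simp add: Y_def)
      show G1': "\<bar>G1 x (W s)\<bar> \<le> C1 * x powr (-\<beta>)"
        using elim(3) WS[OF s] by auto
      have "\<bar>G0 x (W s)\<bar> \<le> C0 * x powr (-\<alpha>)"
        using elim(2) WS[OF s] by auto
      moreover have "\<bar>\<gamma> / x\<bar> = \<bar>\<gamma>\<bar> / x" using elim by simp
      ultimately show d: "\<bar>Y x s - W s\<bar> \<le> \<epsilon> x"
        unfolding Y \<epsilon>_def using G1' by linarith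
      show "\<bar>Y x s\<bar> \<le> B + 1"
        using d elim(1) WB[OF s] by linarith
    qed (use elim in auto)
  qed
  have "lamperti_increments M Y \<gamma> (B + 1)"
  proof
    show "Y x \<in> borel_measurable M" for x by simp
    show "\<forall>\<^sub>F x in at_top. \<forall>s\<in>space M. \<bar>Y x s\<bar> \<le> B + 1"
      using ev by eventually_elim auto
    have "((\<lambda>x. x * expectation (Y x) - \<gamma>) \<longlongrightarrow> 0) at_top"
    proof (rule Lim_null_comparison)
      show "((\<lambda>x::real. C1 * x powr (1 - \<beta>)) \<longlongrightarrow> 0) at_top"
        using \<beta> C1(1) by real_asymp
      show "\<forall>\<^sub>F x in at_top. norm (x * expectation (Y x) - \<gamma>) \<le> C1 * x powr (1 - \<beta>)"
        using ev
      proof eventually_elim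
        case (elim x)
        have i: "integrable M (Y x)" using elim by (intro integrable_bounded(1)[OF Ymeas]) auto
        define Z where "Z s = Y x s - W s - \<gamma> / x - G0 x (W s)" for s
        have Z: "integrable M Z"
          unfolding Z_def using i intW G0_int[of x] elim by auto
        have "expectation Z = expectation (Y x) - \<gamma> / x"
          unfolding Z_def using i intW G0_int[of x] elim mean G0_mean[of x]
          by (simp add: prob_space)
        moreover have "\<bar>expectation Z\<bar> \<le> C1 * x powr (-\<beta>)"
          using elim by (intro abs_expectation_le[OF Z]) (simp add: Z_def)
        ultimately have "x * \<bar>expectation (Y x) - \<gamma> / x\<bar> \<le> x * (C1 * x powr (-\<beta>))"
          using elim by (intro mult_left_mono) auto
        moreover have "x * \<bar>expectation (Y x) - \<gamma> / x\<bar> = \<bar>x * expectation (Y x) - \<gamma>\<bar>"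
          using elim by (simp add: abs_mult_pos' field_simps)
        moreover have "x * (C1 * x powr (-\<beta>)) = C1 * x powr (1 - \<beta>)"
          using elim by (simp add: powr_diff powr_minus field_simps)
        ultimately show ?case by simp
      qed
    qed
    then show "((\<lambda>x. x * expectation (Y x)) \<longlongrightarrow> \<gamma>) at_top"
      by (rule LIM_zero_cancel)
    have "((\<lambda>x. expectation (\<lambda>s. (Y x s)\<^sup>2) - 1) \<longlongrightarrow> 0) at_top"
    proof (rule Lim_null_comparison)
      show "((\<lambda>x. \<epsilon> x * (2 * B + 1)) \<longlongrightarrow> 0) at_top"
        using tendsto_mult_right[OF \<epsilon>0, of "2 * B + 1"] by simp
      show "\<forall>\<^sub>F x in at_top. norm (expectation (\<lambda>s. (Y x s)\<^sup>2) - 1) \<le> \<epsilon> x * (2 * B + 1)"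
        using ev
      proof eventually_elim
        case (elim x)
        have i: "integrable M (\<lambda>s. (Y x s)\<^sup>2)"
          using elim by (intro integrable_bounded(2)[OF Ymeas]) auto
        have "expectation (\<lambda>s. (Y x s)\<^sup>2) - 1 = expectation (\<lambda>s. (Y x s)\<^sup>2 - (W s)\<^sup>2)"
          using i intW2 var by simp
        moreover have "\<bar>expectation (\<lambda>s. (Y x s)\<^sup>2 - (W s)\<^sup>2)\<bar> \<le> \<epsilon> x * (2 * B + 1)"
        proof (rule abs_expectation_le)
          fix s assume s: "s \<in> space M"
          have "\<bar>(Y x s)\<^sup>2 - (W s)\<^sup>2\<bar> = \<bar>Y x s - W s\<bar> * \<bar>Y x s + W s\<bar>"
            by (simp add: power2_eq_square algebra_simps flip: abs_mult)
          also have "\<dots> \<le> \<epsilon> x * (2 * B + 1)"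
          proof (rule mult_mono)
            show dle: "\<bar>Y x s - W s\<bar> \<le> \<epsilon> x" using elim s by blast
            then show "0 \<le> \<epsilon> x" by linarith
            have "\<bar>Y x s\<bar> \<le> B + 1" using elim s by blast
            then show "\<bar>Y x s + W s\<bar> \<le> 2 * B + 1" using WB[OF s] by linarith
          qed simp
          finally show "\<bar>(Y x s)\<^sup>2 - (W s)\<^sup>2\<bar> \<le> \<epsilon> x * (2 * B + 1)" .
        qed (use i intW2 in simp)
        ultimately show ?case by simp
      qed
    qed
    then show "((\<lambda>x. expectation (\<lambda>s. (Y x s)\<^sup>2)) \<longlongrightarrow> 1) at_top"
      by (rule LIM_zero_cancel)
  qed
  then show ?thesis unfolding Y_def[abs_def] .
qed

section \<open>Growth of the chain\<close>

lemma barrier_less_one: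
  assumes "0 < a" "0 \<le> D1" "0 \<le> D2" "0 < t" "0 < x" "barrier a \<nu> D1 D2 t x < 1"
  shows "t powr ((1 - \<nu>) / 2) < x" "x < t powr ((1 + \<nu>) / 2)"
proof -
  have nonneg: "0 \<le> t powr (a * (1 - \<nu>) / 2) * x powr (-a)" "0 \<le> t powr (-\<nu> - 1) * x\<^sup>2"
    "0 \<le> D1 * t powr (-\<nu>)" "0 \<le> D2 * t powr (-(a * \<nu> / 2))"
    using assms by auto
  have lower: "t powr (a * (1 - \<nu>) / 2) * x powr (-a) < 1"
    and upper: "t powr (-\<nu> - 1) * x\<^sup>2 < 1"
    using nonneg assms(6) unfolding barrier_def by linarith+
  show "t powr ((1 - \<nu>) / 2) < x"
  proof (rule ccontr)
    assume "\<not> ?thesis"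
    then have "x powr a \<le> (t powr ((1 - \<nu>) / 2)) powr a"
      using assms by (intro powr_mono2) auto
    also have "\<dots> = t powr (a * (1 - \<nu>) / 2)" by (simp add: powr_powr algebra_simps)
    finally show False using lower assms by (simp add: powr_minus field_simps)
  qed
  show "x < t powr ((1 + \<nu>) / 2)"
  proof (rule power_less_imp_less_base[where n=2])
    have "-\<nu> - 1 = -(1 + \<nu>)" by simp
    then have "t powr (-\<nu> - 1) = 1 / t powr (1 + \<nu>)" by (simp only: powr_minus_divide)
    then have "x\<^sup>2 < t powr (1 + \<nu>)"
      using upper assms by (simp add: pos_divide_less_eq)
    also have "\<dots> = (t powr ((1 + \<nu>) / 2))\<^sup>2"
      by (simp add: power2_eq_square flip: powr_add)
    finally show "x\<^sup>2 < (t powr ((1 + \<nu>) / 2))\<^sup>2" .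
  qed simp
qed

text \<open>
  If the clock starts at \<open>x\<^sup>2\<close> when the chain starts at \<open>x\<close>, then time and squared position are
  comparable, and every summand of the barrier is a negative power of \<open>x\<close>.
\<close>

lemma barrier_start_tendsto_0:
  assumes "0 < a" "0 < \<nu>"
  shows "((\<lambda>x. barrier a \<nu> D1 D2 (x\<^sup>2) x) \<longlongrightarrow> 0) at_top"
proof -
  have "((\<lambda>x::real. x powr (-(a * \<nu>)) + x powr (-(2 * \<nu>)) + D1 * x powr (-(2 * \<nu>))
      + D2 * x powr (-(a * \<nu>))) \<longlongrightarrow> 0 + 0 + D1 * 0 + D2 * 0) at_top"
    using assms by (intro tendsto_intros tendsto_neg_powr filterlim_ident) auto
  moreover have "\<forall>\<^sub>F x in at_top. barrier a \<nu> D1 D2 (x\<^sup>2) x = x powr (-(a * \<nu>)) + x powr (-(2 * \<nu>))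
      + D1 * x powr (-(2 * \<nu>)) + D2 * x powr (-(a * \<nu>))"
    using eventually_gt_at_top[of 0]
  proof eventually_elim
    case (elim x)
    have sq: "(x\<^sup>2) powr e = x powr (2 * e)" for e
      using elim by (simp add: powr_powr flip: powr_numeral)
    have "x powr (2 * (a * (1 - \<nu>) / 2)) * x powr (-a) = x powr (-(a * \<nu>))"
      by (simp add: field_simps flip: powr_add)
    moreover have "x powr (2 * (-\<nu> - 1)) * x\<^sup>2 = x powr (-(2 * \<nu>))"
      using elim powr_add[of x "2 * (-\<nu> - 1)" 2] by simp
    ultimately show ?case unfolding barrier_def sq by simp
  qed
  ultimately show ?thesis by (simp add: tendsto_cong)
qed

text \<open>
  The envelope \<open>x\<^sup>2 + k\<close> provided by the barrier and \<open>(x + sqrt k)\<^sup>2\<close> agree up to a factor of \<open>2\<close>. Half of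
  the exponent \<open>\<nu>\<close> is spent on absorbing this factor.
\<close>

lemma envelope_comparison:
  fixes x k \<nu> :: real
  assumes x: "1 \<le> x" "2 \<le> x powr (\<nu> / 2)" and k: "0 \<le> k" and \<nu>: "0 < \<nu>" "\<nu> \<le> 1"
  shows "(x + sqrt k) powr (1 - \<nu>) \<le> (x\<^sup>2 + k) powr ((1 - \<nu> / 2) / 2)"
    and "(x\<^sup>2 + k) powr ((1 + \<nu> / 2) / 2) \<le> (x + sqrt k) powr (1 + \<nu>)"
proof -
  define S where "S = x + sqrt k"
  have S: "1 \<le> S" "x \<le> S" using add_increasing2[OF real_sqrt_ge_zero[OF k] x(1)] k by (auto simp: S_def)
  have S2: "(S\<^sup>2) powr e = S powr (2 * e)" for e
    using S by (simp add: powr_powr flip: powr_numeral)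
  have half: "S\<^sup>2 / 2 \<le> x\<^sup>2 + k"
  proof -
    have "0 \<le> (x - sqrt k)\<^sup>2" by simp
    then show ?thesis using k by (simp add: S_def power2_sum power2_diff field_simps)
  qed
  have full: "x\<^sup>2 + k \<le> S\<^sup>2"
    using x k by (simp add: S_def power2_sum)
  have "2 \<le> S powr (\<nu> / 2)"
    using x S \<nu> powr_mono2[of "\<nu> / 2" x S] by auto
  moreover have "2 powr ((1 - \<nu> / 2) / 2) \<le> (2::real) powr 1"
    using \<nu> by (intro powr_mono) auto
  ultimately have two: "2 powr ((1 - \<nu> / 2) / 2) \<le> S powr (\<nu> / 2)" by simp
  have "S powr (1 - \<nu>) * 2 powr ((1 - \<nu> / 2) / 2) \<le> S powr (1 - \<nu>) * S powr (\<nu> / 2)"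
    using two by (intro mult_left_mono) auto
  also have "\<dots> = (S\<^sup>2) powr ((1 - \<nu> / 2) / 2)"
    by (simp add: S2 diff_divide_distrib flip: powr_add)
  finally have "S powr (1 - \<nu>) \<le> (S\<^sup>2 / 2) powr ((1 - \<nu> / 2) / 2)"
    by (simp add: powr_divide pos_le_divide_eq)
  also have "\<dots> \<le> (x\<^sup>2 + k) powr ((1 - \<nu> / 2) / 2)"
    using half \<nu> by (intro powr_mono2) auto
  finally show "(x + sqrt k) powr (1 - \<nu>) \<le> (x\<^sup>2 + k) powr ((1 - \<nu> / 2) / 2)"
    by (simp add: S_def)
  have "(x\<^sup>2 + k) powr ((1 + \<nu> / 2) / 2) \<le> (S\<^sup>2) powr ((1 + \<nu> / 2) / 2)"
    using full \<nu> k by (intro powr_mono2) auto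
  also have "\<dots> \<le> S powr (1 + \<nu>)"
    unfolding S2 using S \<nu> by (intro powr_mono) auto
  finally show "(x\<^sup>2 + k) powr ((1 + \<nu> / 2) / 2) \<le> (x + sqrt k) powr (1 + \<nu>)"
    by (simp add: S_def)
qed

text \<open>
  The maximal inequality is applied to the barrier with clock \<open>x0\<^sup>2 + k\<close> at time \<open>k\<close>. Inside the region
  where the barrier is below \<open>1\<close> the chain exceeds \<open>x0 powr (1 - \<mu>)\<close>, so for large \<open>x0\<close> it stays where
  the drift estimates hold. The probability of ever leaving the region is at most the initial value
  of the barrier, which tends to \<open>0\<close>.
\<close>

lemma (in prob_space) chain_growth:
  fixes \<omega> :: "nat \<Rightarrow> 'a \<Rightarrow> real"
  assumes indep: "indep_vars (\<lambda>_. borel) \<omega> UNIV"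
    and ident: "\<And>k l. distr M borel (\<omega> k) = distr M borel (\<omega> l)"
    and F: "case_prod F \<in> borel_measurable borel"
    and incr: "lamperti_increments M (\<lambda>x s. F x (\<omega> 0 s) - x) \<gamma> H"
    and \<gamma>: "1 < 2 * \<gamma>" and \<nu>: "0 < \<nu>" "\<nu> \<le> 1"
  shows "((\<lambda>x0. \<P>(s in M. \<forall>k. (x0 + sqrt (real k)) powr (1 - \<nu>) \<le> chain F \<omega> x0 k s \<and>
                            chain F \<omega> x0 k s \<le> (x0 + sqrt (real k)) powr (1 + \<nu>)))
            \<longlongrightarrow> 1) at_top"
proof -
  interpret L: lamperti_increments M "\<lambda>x s. F x (\<omega> 0 s) - x" \<gamma> H by (rule incr)
  have \<omega>[measurable]: "\<And>k. \<omega> k \<in> borel_measurable M"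
    using indep by (auto simp: indep_vars_def)
  have F'[measurable]: "case_prod F \<in> borel_measurable (borel \<Otimes>\<^sub>M borel)"
    using F by (simp add: borel_prod)
  have Fx[measurable]: "F x \<in> borel_measurable borel" for x
    using measurable_compose[OF measurable_Pair1' F', of x] by simp
  note measurable_chain[OF F \<omega>, measurable]
  define \<mu> where "\<mu> = \<nu> / 2"
  have \<mu>: "0 < \<mu>" "\<mu> < 1" using \<nu> by (auto simp: \<mu>_def)
  obtain a D1 D2 where a: "0 < a" and D: "0 \<le> D1" "0 \<le> D2"
    and drift: "\<forall>\<^sub>F x in at_top. \<forall>t\<ge>1.
      (\<integral>\<^sup>+s. ennreal (barrier a \<mu> D1 D2 (t + 1) (x + (F x (\<omega> 0 s) - x))) \<partial>M)
        \<le> ennreal (barrier a \<mu> D1 D2 t x)"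
    using L.barrier_drift[OF \<gamma> \<mu>] by blast
  have "\<forall>\<^sub>F x in at_top. (\<forall>s\<in>space M. 0 < F x (\<omega> 0 s)) \<and> (\<forall>t\<ge>1.
      (\<integral>\<^sup>+s. ennreal (barrier a \<mu> D1 D2 (t + 1) (F x (\<omega> 0 s))) \<partial>M)
        \<le> ennreal (barrier a \<mu> D1 D2 t x))"
    using drift L.increment_bounded eventually_gt_at_top[of H]
  proof eventually_elim
    case (elim x)
    have "0 < F x (\<omega> 0 s)" if "s \<in> space M" for s
      using elim(2,3) that by (force simp: abs_le_iff)
    with elim(1) show ?case by simp
  qed
  then obtain x1 where x1: "\<And>x. x1 \<le> x \<Longrightarrow> (\<forall>s\<in>space M. 0 < F x (\<omega> 0 s)) \<and> (\<forall>t\<ge>1.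
      (\<integral>\<^sup>+s. ennreal (barrier a \<mu> D1 D2 (t + 1) (F x (\<omega> 0 s))) \<partial>M)
        \<le> ennreal (barrier a \<mu> D1 D2 t x))"
    unfolding eventually_at_top_linorder by blast
  define good where "good x0 s \<longleftrightarrow> (\<forall>k. (x0 + sqrt (real k)) powr (1 - \<nu>) \<le> chain F \<omega> x0 k s \<and>
                            chain F \<omega> x0 k s \<le> (x0 + sqrt (real k)) powr (1 + \<nu>))" for x0 s
  have good_meas[measurable]: "Measurable.pred M (good x0)" for x0
    unfolding good_def by measurable
  have "\<forall>\<^sub>F x0 in at_top. 1 - barrier a \<mu> D1 D2 (x0\<^sup>2) x0 \<le> \<P>(s in M. good x0 s)"
  proof -
    have "\<forall>\<^sub>F x0::real in at_top. 2 \<le> x0 powr (\<nu> / 2)"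
      using \<nu> by real_asymp
    moreover have "\<forall>\<^sub>F x0::real in at_top. x1 \<le> x0 powr (1 - \<mu>)"
      using \<mu> by real_asymp
    ultimately show ?thesis
      using eventually_ge_at_top[of 1]
    proof eventually_elim
      case (elim x0)
      define T where "T k = x0\<^sup>2 + real k" for k
      have T: "1 \<le> T k" "x0\<^sup>2 \<le> T k" "T (Suc k) = T k + 1" for k
        using elim one_le_power[of x0 2] by (auto simp: T_def simp del: one_le_power)
      \<comment> \<open>The value \<open>1\<close> puts nonpositive positions outside the region; the barrier is no obstacle there.\<close>
      define V where "V k x = (if x \<le> 0 then 1 else ennreal (barrier a \<mu> D1 D2 (T k) x))" for k x
      have V_meas[measurable]: "V k \<in> borel_measurable borel" for k
        unfolding V_def[abs_def] barrier_def by measurable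
      have inside: "0 < x \<and> T k powr ((1 - \<mu>) / 2) < x \<and> x < T k powr ((1 + \<mu>) / 2)"
        if "V k x < 1" for k x
      proof -
        have x: "0 < x" and lt: "barrier a \<mu> D1 D2 (T k) x < 1"
          using that by (auto simp: V_def split: if_splits)
        have "0 < T k" using T(1)[of k] by linarith
        from barrier_less_one[OF a D this x lt] x show ?thesis by auto
      qed
      have Vdrift: "(\<integral>\<^sup>+s. V (Suc k) (F x (\<omega> k s)) \<partial>M) \<le> V k x" if "V k x < 1" for k x
      proof -
        have "x1 \<le> x0 powr (1 - \<mu>)" by (rule elim)
        also have "\<dots> = (x0\<^sup>2) powr ((1 - \<mu>) / 2)"
          using elim(3) by (simp add: powr_powr diff_divide_distrib flip: powr_numeral)
        also have "\<dots> \<le> T k powr ((1 - \<mu>) / 2)"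
          using T \<mu> by (intro powr_mono2) auto
        also have "\<dots> < x" using inside[OF that] by simp
        finally have x: "x1 \<le> x" by simp
        have "(\<integral>\<^sup>+s. V (Suc k) (F x (\<omega> k s)) \<partial>M)
            = (\<integral>\<^sup>+w. V (Suc k) (F x w) \<partial>distr M borel (\<omega> k))"
          by (subst nn_integral_distr) auto
        also have "\<dots> = (\<integral>\<^sup>+w. V (Suc k) (F x w) \<partial>distr M borel (\<omega> 0))"
          by (simp only: ident[of k 0])
        also have "\<dots> = (\<integral>\<^sup>+s. V (Suc k) (F x (\<omega> 0 s)) \<partial>M)"
          by (subst nn_integral_distr) auto
        also have "\<dots> = (\<integral>\<^sup>+s. ennreal (barrier a \<mu> D1 D2 (T k + 1) (F x (\<omega> 0 s))) \<partial>M)"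
          using x1[OF x] by (intro nn_integral_cong) (auto simp: V_def T(3) not_le)
        also have "\<dots> \<le> ennreal (barrier a \<mu> D1 D2 (T k) x)"
          using x1[OF x] T(1) by blast
        also have "\<dots> = V k x"
          using inside[OF that] by (simp add: V_def)
        finally show ?thesis .
      qed
      define bad where "bad = {s\<in>space M. \<exists>k. 1 \<le> V k (chain F \<omega> x0 k s)}"
      have bad: "bad \<in> events" "emeasure M bad \<le> V 0 x0"
        unfolding bad_def by (rule chain_maximal_inequality[OF indep F V_meas Vdrift]; assumption)+
      have nonneg: "0 \<le> barrier a \<mu> D1 D2 (x0\<^sup>2) x0"
        using D by (simp add: barrier_def)
      have "emeasure M bad \<le> ennreal (barrier a \<mu> D1 D2 (x0\<^sup>2) x0)"
        using bad(2) elim(3) by (simp add: V_def T_def)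
      then have "prob bad \<le> barrier a \<mu> D1 D2 (x0\<^sup>2) x0"
        using nonneg by (simp add: emeasure_eq_measure)
      moreover have "space M - bad \<subseteq> {s\<in>space M. good x0 s}"
      proof
        fix s assume s: "s \<in> space M - bad"
        have "(x0 + sqrt (real k)) powr (1 - \<nu>) \<le> chain F \<omega> x0 k s \<and>
              chain F \<omega> x0 k s \<le> (x0 + sqrt (real k)) powr (1 + \<nu>)" for k
        proof -
          have "V k (chain F \<omega> x0 k s) < 1" using s by (auto simp: bad_def not_le)
          from inside[OF this] show ?thesis
            using envelope_comparison[OF elim(3,1) _ \<nu>, of "real k"]
            by (auto simp: \<mu>_def T_def)
        qed
        then show "s \<in> {s\<in>space M. good x0 s}" using s by (auto simp: good_def)
      qed
      then have "prob (space M - bad) \<le> \<P>(s in M. good x0 s)"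
        by (intro finite_measure_mono) auto
      ultimately show ?case using bad(1) by (simp add: prob_compl)
    qed
  qed
  moreover have "((\<lambda>x0. 1 - barrier a \<mu> D1 D2 (x0\<^sup>2) x0) \<longlongrightarrow> 1 - 0) at_top"
    using a \<mu> by (intro tendsto_intros barrier_start_tendsto_0)
  ultimately have "((\<lambda>x0. \<P>(s in M. good x0 s)) \<longlongrightarrow> 1) at_top"
    using tendsto_sandwich[of "\<lambda>x0. 1 - barrier a \<mu> D1 D2 (x0\<^sup>2) x0" "\<lambda>x0. \<P>(s in M. good x0 s)"
        at_top "\<lambda>_. 1" 1] by (simp add: prob_le_1)
  then show ?thesis by (simp add: good_def)
qed

theorem theorem3p1:
  fixes P :: "'a measure"
    and \<omega> :: "nat \<Rightarrow> 'a \<Rightarrow> real"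
    and M \<gamma> \<xi>m \<xi>p \<alpha> \<beta> :: real
    and F G0 G1 :: "real \<Rightarrow> real \<Rightarrow> real"
  assumes prob: "prob_space P"
    and M: "M \<ge> 1"
    and indep: "prob_space.indep_vars P (\<lambda>_. borel) \<omega> UNIV"
    and ident: "\<And>k l. distr P borel (\<omega> k) = distr P borel (\<omega> l)"
    and bounded: "\<And>k s. s \<in> space P \<Longrightarrow> \<bar>\<omega> k s\<bar> \<le> M"
    and mean: "\<And>k. prob_space.expectation P (\<omega> k) = 0"
    and second_moment: "\<And>k. prob_space.expectation P (\<lambda>s. (\<omega> k s)\<^sup>2) = 1"
    and F_pos: "\<And>\<xi> w. \<xi> > 0 \<Longrightarrow> w \<in> {-M..M} \<Longrightarrow> F \<xi> w > 0"
    and F_meas: "(\<lambda>(\<xi>, w). F \<xi> w) \<in> borel_measurable (restrict_space borel ({0<..} \<times> {-M..M}))"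
    and xi_minus: "0 < \<xi>m" and xi_plus: "\<xi>m < \<xi>p"
    and alpha: "\<alpha> > 0" and beta: "\<beta> > 1"
    and F_cont: "continuous_on ({\<xi>m..} \<times> {-M..M}) (\<lambda>(\<xi>, w). F \<xi> w)"
    and F_expansion: "\<And>\<xi> w. \<xi> > \<xi>p \<Longrightarrow> w \<in> {-M..M} \<Longrightarrow>
          F \<xi> w = \<xi> + w + \<gamma> / \<xi> + G0 \<xi> w + G1 \<xi> w"
    and G0_bigo: "sup_bigo {-M..M} G0 (\<lambda>\<xi>. \<xi> powr (-\<alpha>))"
    and G1_bigo: "sup_bigo {-M..M} G1 (\<lambda>\<xi>. \<xi> powr (-\<beta>))"
    and G0_integrable: "\<And>\<xi> k. \<xi> > \<xi>p \<Longrightarrow> integrable P (\<lambda>s. G0 \<xi> (\<omega> k s))"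
    and G0_mean: "\<And>\<xi> k. \<xi> > \<xi>p \<Longrightarrow> prob_space.expectation P (\<lambda>s. G0 \<xi> (\<omega> k s)) = 0"
    and gamma: "\<gamma> > 1/2"
  shows "(\<forall>p \<nu>. 0 < p \<and> p \<le> 1 \<and> 0 < \<nu> \<longrightarrow>
           (\<exists>\<xi>star>\<xi>p. \<forall>\<xi>0\<ge>\<xi>star.
              \<P>(s in P. \<forall>k. (\<xi>0 + sqrt (real k)) powr (1 - \<nu>) \<le> chain F \<omega> \<xi>0 k s \<and>
                              chain F \<omega> \<xi>0 k s \<le> (\<xi>0 + sqrt (real k)) powr (1 + \<nu>)) \<ge> 1 - p)) \<and>
         (\<forall>\<nu>>0. ((\<lambda>\<xi>0.
              \<P>(s in P. \<forall>k. (\<xi>0 + sqrt (real k)) powr (1 - \<nu>) \<le> chain F \<omega> \<xi>0 k s \<and>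
                              chain F \<omega> \<xi>0 k s \<le> (\<xi>0 + sqrt (real k)) powr (1 + \<nu>)))
            \<longlongrightarrow> 1) at_top)"
proof -
  interpret prob_space P by (rule prob)
  \<comment> \<open>\<open>F\<close> is measurable only on its domain; extended by a constant it is measurable everywhere, and the
    chain never sees the difference.\<close>
  define F' where "F' x w = (if (x, w) \<in> {0<..} \<times> {-M..M} then F x w else 0)" for x w
  define S :: "(real \<times> real) set" where "S = {0<..} \<times> {-M..M}"
  have S: "S \<in> sets borel" unfolding S_def by (intro borel_Times) auto
  have "(\<lambda>p. if p \<in> S then case_prod F p else 0) \<in> borel_measurable borel"
    using F_meas S unfolding S_def[symmetric] by (subst (asm) measurable_restrict_space_iff) auto
  also have "(\<lambda>p. if p \<in> S then case_prod F p else 0) = case_prod F'"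
    by (auto simp: fun_eq_iff F'_def S_def)
  finally have F': "case_prod F' \<in> borel_measurable borel" .
  have F'x: "F' x \<in> borel_measurable borel" for x
    using measurable_compose[OF measurable_Pair1'[of x borel borel], of "case_prod F'" borel] F'
    by (simp add: borel_prod)
  have W: "\<omega> 0 \<in> borel_measurable P"
    using indep by (auto simp: indep_vars_def)
  have pos: "0 < \<xi>p" using xi_minus xi_plus by simp
  have exp': "F' \<xi> w = \<xi> + w + \<gamma> / \<xi> + G0 \<xi> w + G1 \<xi> w"
    if "\<xi>p < \<xi>" "w \<in> {-M..M}" for \<xi> w
    using F_expansion[OF that] that pos by (simp add: F'_def)
  have incr: "lamperti_increments P (\<lambda>x s. F' x (\<omega> 0 s) - x) \<gamma> (M + 1)"
    using W bounded mean second_moment F'x alpha beta exp' G0_bigo G1_bigo G0_integrable G0_mean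
    by (rule lamperti_increments_of_expansion)
  have chain_F': "0 < chain F \<omega> \<xi>0 k s \<and> chain F' \<omega> \<xi>0 k s = chain F \<omega> \<xi>0 k s"
    if "0 < \<xi>0" "s \<in> space P" for \<xi>0 k s
  proof (induction k)
    case (Suc k)
    have "\<omega> k s \<in> {-M..M}" using bounded[OF that(2), of k] by auto
    with Suc F_pos show ?case by (simp add: F'_def)
  qed (use that in simp)
  \<comment> \<open>For the two exponents to be comparable the base has to be at least \<open>1\<close>, and then the event grows
    with \<open>\<nu>\<close>; hence it suffices to treat \<open>\<nu> \<le> 1\<close>.\<close>
  define Q where "Q \<nu> \<xi>0 = \<P>(s in P. \<forall>k. (\<xi>0 + sqrt (real k)) powr (1 - \<nu>) \<le> chain F \<omega> \<xi>0 k s \<and>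
                              chain F \<omega> \<xi>0 k s \<le> (\<xi>0 + sqrt (real k)) powr (1 + \<nu>))" for \<nu> \<xi>0
  define Q' where "Q' \<nu> \<xi>0 = \<P>(s in P. \<forall>k. (\<xi>0 + sqrt (real k)) powr (1 - \<nu>) \<le> chain F' \<omega> \<xi>0 k s \<and>
                              chain F' \<omega> \<xi>0 k s \<le> (\<xi>0 + sqrt (real k)) powr (1 + \<nu>))" for \<nu> \<xi>0
  have QQ': "Q \<nu> \<xi>0 = Q' \<nu> \<xi>0" if "0 < \<xi>0" for \<nu> \<xi>0
    unfolding Q_def Q'_def using chain_F'[OF that] by (intro arg_cong[of _ _ "measure P"]) auto
  note measurable_chain[OF F', of \<omega> P, measurable]
  have \<omega>[measurable]: "\<omega> k \<in> borel_measurable P" for k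
    using indep by (auto simp: indep_vars_def)
  have lim: "(Q \<nu> \<longlongrightarrow> 1) at_top" if "0 < \<nu>" for \<nu>
  proof -
    have "(Q' (min \<nu> 1) \<longlongrightarrow> 1) at_top"
      unfolding Q'_def[abs_def] using that gamma
      by (intro chain_growth[OF indep ident F' incr]) auto
    moreover have "\<forall>\<^sub>F \<xi>0 in at_top. Q' (min \<nu> 1) \<xi>0 \<le> Q \<nu> \<xi>0"
      using eventually_ge_at_top[of 1]
    proof eventually_elim
      case (elim \<xi>0)
      have "Q' (min \<nu> 1) \<xi>0 \<le> Q' \<nu> \<xi>0"
        unfolding Q'_def
      proof (rule finite_measure_mono)
        have base: "1 \<le> \<xi>0 + sqrt (real k)" for k
          using elim add_increasing2[of "sqrt (real k)" 1 \<xi>0] by simp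
        have "(\<xi>0 + sqrt (real k)) powr (1 - \<nu>) \<le> (\<xi>0 + sqrt (real k)) powr (1 - min \<nu> 1)"
          "(\<xi>0 + sqrt (real k)) powr (1 + min \<nu> 1) \<le> (\<xi>0 + sqrt (real k)) powr (1 + \<nu>)" for k
          using base[of k] by (auto intro: powr_mono)
        then show "{s \<in> space P. \<forall>k. (\<xi>0 + sqrt (real k)) powr (1 - min \<nu> 1) \<le> chain F' \<omega> \<xi>0 k s \<and>
            chain F' \<omega> \<xi>0 k s \<le> (\<xi>0 + sqrt (real k)) powr (1 + min \<nu> 1)}
          \<subseteq> {s \<in> space P. \<forall>k. (\<xi>0 + sqrt (real k)) powr (1 - \<nu>) \<le> chain F' \<omega> \<xi>0 k s \<and>
            chain F' \<omega> \<xi>0 k s \<le> (\<xi>0 + sqrt (real k)) powr (1 + \<nu>)}"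
          by (blast intro: order_trans)
      qed measurable
      then show ?case using QQ' elim by simp
    qed
    ultimately show ?thesis
      using tendsto_sandwich[of "Q' (min \<nu> 1)" "Q \<nu>" at_top "\<lambda>_. 1" 1] by (simp add: Q_def prob_le_1)
  qed
  have star: "\<exists>\<xi>star>\<xi>p. \<forall>\<xi>0\<ge>\<xi>star. 1 - p \<le> Q \<nu> \<xi>0" if "0 < p" "0 < \<nu>" for p \<nu>
  proof -
    have "\<forall>\<^sub>F \<xi>0 in at_top. 1 - p < Q \<nu> \<xi>0"
      using lim[OF that(2)] that(1) by (intro order_tendstoD(1)) auto
    then obtain N where N: "\<And>\<xi>0. N \<le> \<xi>0 \<Longrightarrow> 1 - p < Q \<nu> \<xi>0"
      unfolding eventually_at_top_linorder by blast
    show ?thesis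
      by (rule exI[of _ "max N (\<xi>p + 1)"]) (auto intro: less_imp_le N)
  qed
  show ?thesis
    using lim star unfolding Q_def[abs_def] by blast
qed

end
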